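(* Let $G$ be a connected graph of order $n$ and size $m$, and let $\nu'_1$ and $\nu'_n$ denote respectively the maximum and the minimum of the numbers $|\mu'_i-\zeta(G)/n|$, $i=1,\dots,n$. Then \[LE_\varepsilon(G)\ge\frac{2\sqrt{\nu'_1\nu'_n}}{\nu'_1+\nu'_n}\sqrt{nE_1(G)-\zeta(G)^2+2mn}.\]
   Context: $G$ is simple with vertices $v_1,\dots,v_n$. $\varepsilon_G(v)=\max_{u} d_G(u,v)$ is the eccentricity ($d_G$ = shortest-path distance); $\zeta(G)=\sum_i\varepsilon_G(v_i)$; $E_1(G)=\sum_i\varepsilon_G(v_i)^2$. $\mu'_1,\dots,\mu'_n$ are the eigenvalues of $L_\varepsilon(G)=\varepsilon(G)-A(G)$, where $A(G)$ is the adjacency matrix and $\varepsilon(G)$ the diagonal matrix with entries $\varepsilon_G(v_i)$. $LE_\varepsilon(G)=\sum_{i=1}^n|\mu'_i-\zeta(G)/n|$. *)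

theory Defs
  imports
    "Jordan_Normal_Form.Char_Poly"
    "Graph_Theory.Graph_Theory"
begin

text \<open>
  A simple graph is a \<^locale>\<open>pair_graph\<close>: a finite vertex set with a symmetric, loop-free set
  of pairs of vertices. Each undirected edge is thus present as two arcs.
\<close>

definition graph_size :: "'a pair_pre_digraph \<Rightarrow> nat" where
  "graph_size G = card ((\<lambda>(u, v). {u, v}) ` parcs G)"

definition graph_dist :: "'a pair_pre_digraph \<Rightarrow> 'a \<Rightarrow> 'a \<Rightarrow> ereal" where
  "graph_dist G u v = wf_digraph.\<mu> (with_proj G) (\<lambda>_. 1) u v"

text \<open>
  In a connected graph all distances are finite, so that the conversion to the reals loses nothing.
\<close>

definition ecc :: "'a pair_pre_digraph \<Rightarrow> 'a \<Rightarrow> real" where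
  "ecc G v = real_of_ereal (Max ((\<lambda>u. graph_dist G u v) ` pverts G))"

definition total_ecc :: "'a pair_pre_digraph \<Rightarrow> real" where
  "total_ecc G = (\<Sum>v\<in>pverts G. ecc G v)"

definition zagreb_ecc :: "'a pair_pre_digraph \<Rightarrow> real" where
  "zagreb_ecc G = (\<Sum>v\<in>pverts G. (ecc G v)\<^sup>2)"

text \<open>
  In the following the list \<open>vs\<close> enumerates the vertices without repetition; it fixes the order of
  the rows and columns.
\<close>

definition adj_mat :: "'a pair_pre_digraph \<Rightarrow> 'a list \<Rightarrow> real mat" where
  "adj_mat G vs = mat (length vs) (length vs)
     (\<lambda>(i, j). if (vs ! i, vs ! j) \<in> parcs G then 1 else 0)"

definition ecc_mat :: "'a pair_pre_digraph \<Rightarrow> 'a list \<Rightarrow> real mat" where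
  "ecc_mat G vs = mat_diag (length vs) (\<lambda>i. ecc G (vs ! i))"

definition ecc_laplacian :: "'a pair_pre_digraph \<Rightarrow> 'a list \<Rightarrow> real mat" where
  "ecc_laplacian G vs = ecc_mat G vs - adj_mat G vs"

text \<open>
  The eigenvalues of a real square matrix, each as often as its multiplicity as a root of the
  characteristic polynomial. For a symmetric matrix these are all of its complex eigenvalues.
\<close>

definition eigenvalue_mset :: "real mat \<Rightarrow> real multiset" where
  "eigenvalue_mset A = proots (char_poly A)"

lemma set_eigenvalue_mset:
  assumes "A \<in> carrier_mat n n"
  shows "set_mset (eigenvalue_mset A) = {k. eigenvalue A k}"
proof -
  have "char_poly A \<noteq> 0"
    using degree_monic_char_poly[OF assms] by (metis coeff_0 zero_neq_one)
  then show ?thesis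
    unfolding eigenvalue_mset_def eigenvalue_root_char_poly[OF assms]
    by (rule set_count_proots)
qed

definition ecc_deviations :: "'a pair_pre_digraph \<Rightarrow> 'a list \<Rightarrow> real multiset" where
  "ecc_deviations G vs =
     image_mset (\<lambda>x. \<bar>x - total_ecc G / real (card (pverts G))\<bar>)
       (eigenvalue_mset (ecc_laplacian G vs))"

definition ecc_laplacian_energy :: "'a pair_pre_digraph \<Rightarrow> 'a list \<Rightarrow> real" where
  "ecc_laplacian_energy G vs = sum_mset (ecc_deviations G vs)"

end

theory Submission
  imports Defs "Jordan_Normal_Form.Schur_Decomposition"
begin

text \<open>
  Let \<open>d\<^sub>i\<close> be the deviations, \<open>a\<close> their minimum and \<open>b\<close> their maximum. Summing
  \<open>(d\<^sub>i - a) * (d\<^sub>i - b) \<le> 0\<close> gives \<open>\<Sum>d\<^sub>i\<^sup>2 + n * a * b \<le> (a + b) * \<Sum>d\<^sub>i\<close>, and the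
  inequality of arithmetic and geometric means bounds the left-hand side from below by
  \<open>2 * sqrt (a * b) * sqrt (n * \<Sum>d\<^sub>i\<^sup>2)\<close>. The symmetric real matrix is triangularizable over
  the reals, so \<open>\<Sum>d\<^sub>i\<^sup>2\<close> can be read off the traces of the matrix and of its square.
\<close>

section \<open>Traces and eigenvalues\<close>

definition trace :: "'a::comm_monoid_add mat \<Rightarrow> 'a" where
  "trace A = (\<Sum>i<dim_row A. A $$ (i, i))"

lemma trace_eq_sum_list_diag: "trace A = sum_list (diag_mat A)"
  by (simp add: trace_def diag_mat_def interv_sum_list_conv_sum_set_nat atLeast0LessThan)

lemma trace_mult:
  fixes A B :: "'a::semiring_0 mat"
  assumes "A \<in> carrier_mat n k" "B \<in> carrier_mat k n"
  shows "trace (A * B) = (\<Sum>i<n. \<Sum>j<k. A $$ (i, j) * B $$ (j, i))"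
  using assms by (auto simp: trace_def scalar_prod_def atLeast0LessThan intro!: sum.cong)

lemma trace_mult_commute:
  fixes A B :: "'a::comm_semiring_0 mat"
  assumes "A \<in> carrier_mat n k" "B \<in> carrier_mat k n"
  shows "trace (A * B) = trace (B * A)"
  unfolding trace_mult[OF assms] trace_mult[OF assms(2,1)]
  by (subst sum.swap) (simp add: mult.commute)

text \<open>With \<open>A = P * B * Q\<close>, commuting under the trace brings \<open>Q\<close> to
  the front, where it cancels against \<open>P\<close>.\<close>

lemma trace_similar_mat:
  fixes A B :: "'a::comm_ring_1 mat"
  assumes "similar_mat A B"
  shows "trace A = trace B"
proof -
  from assms obtain n P Q where c: "{A, B, P, Q} \<subseteq> carrier_mat n n"
    and QP: "Q * P = 1\<^sub>m n" and A: "A = P * B * Q"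
    using similar_matD[OF assms] by metis
  then have "trace A = trace (Q * (P * B))"
    by (auto intro!: trace_mult_commute)
  also have "Q * (P * B) = B"
    using c QP by (subst assoc_mult_mat[symmetric, of Q n n P n B n]) auto
  finally show ?thesis .
qed

text \<open>For \<open>j\<close> different from \<open>i\<close>, one of the positions
  \<open>(i, j)\<close> and \<open>(j, i)\<close> lies below the diagonal, so only
  \<open>j = i\<close> contributes to a diagonal entry of the product.\<close>

lemma diag_mat_mult_upper_triangular:
  fixes A :: "'a::semiring_1 mat"
  assumes A: "A \<in> carrier_mat n n" and "upper_triangular A"
  shows "diag_mat (A * A) = map (\<lambda>x. x\<^sup>2) (diag_mat A)"
proof (rule nth_equalityI)
  fix i assume "i < length (diag_mat (A * A))"
  then have i: "i < n"
    using A by (simp add: diag_mat_def)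
  have "(\<Sum>j\<in>{0..<n}. A $$ (i, j) * A $$ (j, i)) = (\<Sum>j\<in>{i}. A $$ (i, j) * A $$ (j, i))"
  proof (rule sum.mono_neutral_right)
    show "\<forall>j\<in>{0..<n} - {i}. A $$ (i, j) * A $$ (j, i) = 0"
    proof
      fix j assume "j \<in> {0..<n} - {i}"
      then consider "j < i" | "i < j" "j < n"
        by fastforce
      then show "A $$ (i, j) * A $$ (j, i) = 0"
        by cases (use assms i in \<open>auto dest: upper_triangularD\<close>)
    qed
  qed (use i in auto)
  then show "diag_mat (A * A) ! i = map (\<lambda>x. x\<^sup>2) (diag_mat A) ! i"
    using A i by (simp add: diag_mat_def scalar_prod_def power2_eq_square)
qed (simp add: diag_mat_def)

text \<open>Once the characteristic polynomial splits over the field itself, Schur decomposition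
  yields a similar triangular matrix with diagonal \<open>es\<close>, and both traces are read off
  there.\<close>

lemma trace_linear_factors:
  fixes A :: "'a::conjugatable_ordered_field mat"
  assumes A: "A \<in> carrier_mat n n" and cp: "char_poly A = (\<Prod>e\<leftarrow>es. [:- e, 1:])"
  shows "trace A = sum_list es" "trace (A * A) = (\<Sum>e\<leftarrow>es. e\<^sup>2)"
proof -
  obtain B P Q where "schur_decomposition A es = (B, P, Q)"
    by (cases "schur_decomposition A es")
  from schur_decomposition[OF A cp this]
  have wit: "similar_mat_wit A B P Q" and ut: "upper_triangular B" and diag: "diag_mat B = es"
    by auto
  have B: "B \<in> carrier_mat n n"
    using similar_mat_witD2[OF A wit] by auto
  have sim: "similar_mat A B"
    using wit by (auto simp: similar_mat_def)
  from trace_similar_mat[OF this] show "trace A = sum_list es"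
    by (simp add: trace_eq_sum_list_diag diag)
  \<comment> \<open>The witnesses \<open>P\<close> and \<open>Q\<close> also relate the powers of
    \<open>A\<close> and \<open>B\<close>; exponent 2 unfolds to the products.\<close>
  have "similar_mat (A * A) (B * B)"
    using similar_mat_wit_pow[OF wit, of 2] A B
    by (auto simp: similar_mat_def numeral_2_eq_2)
  from trace_similar_mat[OF this] show "trace (A * A) = (\<Sum>e\<leftarrow>es. e\<^sup>2)"
    by (simp add: trace_eq_sum_list_diag diag_mat_mult_upper_triangular[OF B ut] diag)
qed

text \<open>The scalar product of \<open>?A *\<^sub>v v\<close> with the conjugate of
  \<open>v\<close> is evaluated in two ways, giving \<open>e\<close> and \<open>cnj e\<close> times
  the same nonzero number.\<close>

lemma symmetric_real_mat_eigenvalue_real: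
  fixes A :: "real mat"
  assumes A: "A \<in> carrier_mat n n" and sym: "transpose_mat A = A"
    and ev: "eigenvalue (map_mat complex_of_real A) e"
  shows "e \<in> \<real>"
proof -
  let ?A = "map_mat complex_of_real A"
  have cA: "?A \<in> carrier_mat n n" and symC: "transpose_mat ?A = ?A"
    using A sym by (auto simp: map_mat_transpose)
  from ev obtain v where v: "v \<in> carrier_vec n" "v \<noteq> 0\<^sub>v n" and Av: "?A *\<^sub>v v = e \<cdot>\<^sub>v v"
    using cA by (auto simp: eigenvalue_def eigenvector_def)
  have cv: "conjugate v \<in> carrier_vec n"
    using v by simp
  \<comment> \<open>The entries of \<open>?A\<close> are real, hence fixed by conjugation.\<close>
  have "?A *\<^sub>v conjugate v = conjugate (?A *\<^sub>v v)"
    using A v by (intro eq_vecI) (auto simp: scalar_prod_def intro!: sum.cong)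
  also have "\<dots> = cnj e \<cdot>\<^sub>v conjugate v"
    unfolding Av by (simp add: conjugate_smult_vec)
  finally have Acv: "?A *\<^sub>v conjugate v = cnj e \<cdot>\<^sub>v conjugate v" .
  have "e * (v \<bullet>c v) = (?A *\<^sub>v v) \<bullet>c v"
    unfolding Av using v by simp
  \<comment> \<open>Symmetry moves the matrix to the other factor.\<close>
  also have "\<dots> = v \<bullet> (?A *\<^sub>v conjugate v)"
    using transpose_vec_mult_scalar[OF cA cv v(1)] symC v cA cv
    by (metis comm_scalar_prod mult_mat_vec_carrier)
  also have "\<dots> = cnj e * (v \<bullet>c v)"
    unfolding Acv using v by simp
  finally have "e = cnj e"
    using v by simp
  then show ?thesis
    by (metis Reals_cnj_iff)
qed

text \<open>The polynomial splits over the complex numbers with real roots only; since embedding the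
  coefficients is injective, the factorization descends to the reals.\<close>

lemma symmetric_real_mat_char_poly_linear_factors:
  fixes A :: "real mat"
  assumes A: "A \<in> carrier_mat n n" and sym: "transpose_mat A = A"
  obtains es where "char_poly A = (\<Prod>e\<leftarrow>es. [:- e, 1:])" "length es = n"
proof -
  let ?A = "map_mat complex_of_real A"
  interpret h: map_poly_inj_comm_ring_hom complex_of_real ..
  have cA: "?A \<in> carrier_mat n n"
    using A by simp
  from char_poly_factorized[OF cA] obtain cs
    where cs: "char_poly ?A = (\<Prod>c\<leftarrow>cs. [:- c, 1:])" "length cs = n" by blast
  define es where "es = map Re cs"
  have "c \<in> \<real>" if "c \<in> set cs" for c
  proof -
    have "poly (char_poly ?A) c = 0"
      unfolding cs using that by (induction cs) auto
    then show ?thesis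
      using symmetric_real_mat_eigenvalue_real[OF A sym] eigenvalue_root_char_poly[OF cA] by blast
  qed
  then have cs_eq: "cs = map complex_of_real es"
    by (auto simp: es_def map_idI Reals_def)
  have "map_poly complex_of_real (char_poly A) = char_poly ?A"
    by (rule of_real_hom.char_poly_hom[OF A, symmetric])
  also have "\<dots> = map_poly complex_of_real (\<Prod>e\<leftarrow>es. [:- e, 1:])"
    unfolding cs cs_eq by (simp add: h.hom_prod_list o_def)
  finally have "char_poly A = (\<Prod>e\<leftarrow>es. [:- e, 1:])"
    by simp
  then show thesis
    using that[of es] cs(2) by (simp add: es_def)
qed

text \<open>Links the eigenvalues as defined, with multiplicity, to the list \<open>es\<close> for
  which the trace identities hold.\<close>

lemma eigenvalue_mset_linear_factors:
  assumes "char_poly A = (\<Prod>e\<leftarrow>es. [:- e, 1:])"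
  shows "eigenvalue_mset A = mset es"
proof -
  have "proots (\<Prod>e\<leftarrow>es. [:- e, 1::real:]) = mset es"
  proof (induction es)
    case (Cons a es)
    have "(\<Prod>e\<leftarrow>es. [:- e, 1::real:]) \<noteq> 0"
      by (auto simp: prod_list_zero_iff)
    then have "proots ([:- a, 1:] * (\<Prod>e\<leftarrow>es. [:- e, 1:])) = {#a#} + mset es"
      by (subst proots_mult) (simp_all add: Cons)
    then show ?case
      by simp
  qed simp
  then show ?thesis
    by (simp add: eigenvalue_mset_def assms)
qed

section \<open>The eccentricity Laplacian\<close>

text \<open>The map from arcs to edges has fibres of size exactly two: symmetry supplies the reverse
  arc, and the absence of loops makes it a different one.\<close>

lemma (in pair_graph) card_parcs_eq_twice_graph_size: "card (parcs G) = 2 * graph_size G"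
proof -
  let ?f = "\<lambda>(u, v). {u, v}"
  have "card {y \<in> parcs G. ?f y = e} = 2" if "e \<in> ?f ` parcs G" for e
  proof -
    obtain u v where uv: "(u, v) \<in> parcs G" "e = {u, v}"
      using \<open>e \<in> ?f ` parcs G\<close> by (force elim!: imageE)
    then have "(v, u) \<in> parcs G" "u \<noteq> v"
      using arcs_symmetric pair_no_loops by fastforce+
    with uv have "{y \<in> parcs G. ?f y = e} = {(u, v), (v, u)}"
      by (auto simp: doubleton_eq_iff)
    with \<open>u \<noteq> v\<close> show ?thesis
      by simp
  qed
  then show ?thesis
    using sum.image_gen[of "parcs G" "\<lambda>_. 1::nat" ?f] by (simp add: graph_size_def)
qed

lemma sum_nth_enumeration:
  assumes "distinct vs"
  shows "(\<Sum>i<length vs. f (vs ! i)) = sum f (set vs)"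
  using bij_betw_nth[OF assms refl refl]
  by (rule sum.reindex_bij_betw)

lemma ecc_laplacian_carrier: "ecc_laplacian G vs \<in> carrier_mat (length vs) (length vs)"
  by (auto simp: ecc_laplacian_def ecc_mat_def adj_mat_def)

lemma ecc_laplacian_index:
  assumes "i < length vs" "j < length vs"
  shows "ecc_laplacian G vs $$ (i, j) =
    (if i = j then ecc G (vs ! i) else 0) - (if (vs ! i, vs ! j) \<in> parcs G then 1 else 0)"
  using assms by (auto simp: ecc_laplacian_def ecc_mat_def adj_mat_def mat_diag_def)

lemma (in pair_graph) transpose_ecc_laplacian:
  "transpose_mat (ecc_laplacian G vs) = ecc_laplacian G vs"
  using ecc_laplacian_carrier[of G vs]
  by (intro eq_matI) (auto simp: ecc_laplacian_index dest: arcs_symmetric)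

lemma (in pair_graph) trace_ecc_laplacian:
  assumes "distinct vs" "set vs = pverts G"
  shows "trace (ecc_laplacian G vs) = total_ecc G"
proof -
  have "(v, v) \<notin> parcs G" for v
    using pair_no_loops by fastforce
  then show ?thesis
    using ecc_laplacian_carrier[of G vs] sum_nth_enumeration[OF assms(1), of "ecc G"] assms(2)
    by (simp add: trace_def ecc_laplacian_index total_ecc_def)
qed

lemma (in pair_graph) trace_ecc_laplacian_square:
  assumes "distinct vs" "set vs = pverts G"
  shows "trace (ecc_laplacian G vs * ecc_laplacian G vs) = zagreb_ecc G + 2 * graph_size G"
proof -
  let ?L = "ecc_laplacian G vs" and ?n = "length vs"
  let ?a = "\<lambda>u v. if (u, v) \<in> parcs G then 1 else 0 :: real"
  have no_loop: "(v, v) \<notin> parcs G" for v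
    using pair_no_loops by fastforce
  have "trace (?L * ?L) = (\<Sum>i<?n. \<Sum>j<?n. ?L $$ (i, j) * ?L $$ (j, i))"
    by (rule trace_mult) (rule ecc_laplacian_carrier)+
  \<comment> \<open>Without loops the eccentricity part and the adjacency part have disjoint
    supports, so there are no mixed terms; each arc contributes
    \<open>(-1) * (-1) = 1\<close>.\<close>
  also have "\<dots> = (\<Sum>i<?n. \<Sum>j<?n.
      (if i = j then (ecc G (vs ! i))\<^sup>2 else 0) + ?a (vs ! i) (vs ! j))"
    by (intro sum.cong refl)
      (auto simp: ecc_laplacian_index no_loop power2_eq_square dest: arcs_symmetric)
  also have "\<dots> = (\<Sum>i<?n. (ecc G (vs ! i))\<^sup>2) + (\<Sum>i<?n. \<Sum>j<?n. ?a (vs ! i) (vs ! j))"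
    by (simp add: sum.distrib)
  also have "(\<Sum>i<?n. (ecc G (vs ! i))\<^sup>2) = zagreb_ecc G"
    using sum_nth_enumeration[OF assms(1), of "\<lambda>v. (ecc G v)\<^sup>2"] assms(2)
    by (simp add: zagreb_ecc_def)
  also have "(\<Sum>i<?n. \<Sum>j<?n. ?a (vs ! i) (vs ! j)) =
      (\<Sum>u\<in>pverts G. \<Sum>v\<in>pverts G. ?a u v)"
    unfolding sum_nth_enumeration[OF assms(1), of "\<lambda>v. ?a u v" for u]
    using sum_nth_enumeration[OF assms(1), of "\<lambda>u. \<Sum>v\<in>set vs. ?a u v"] assms(2) by simp
  also have "\<dots> = (\<Sum>e\<in>pverts G \<times> pverts G. if e \<in> parcs G then 1 else 0)"
    by (simp add: sum.cartesian_product split_def)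
  also have "\<dots> = card (parcs G)"
  proof -
    have "(pverts G \<times> pverts G) \<inter> parcs G = parcs G"
      using arc_fst_in_verts arc_snd_in_verts by fastforce
    then show ?thesis
      by (simp add: sum.If_cases)
  qed
  finally show ?thesis
    by (simp add: card_parcs_eq_twice_graph_size)
qed

section \<open>The lower bound\<close>

text \<open>If \<open>a + b = 0\<close>, the quotient is \<open>0\<close> by convention.\<close>

lemma sum_list_ge_sqrt_sum_squares:
  fixes ds :: "real list" and a b :: real
  assumes ab: "0 \<le> a" and bnd: "\<And>d. d \<in> set ds \<Longrightarrow> a \<le> d \<and> d \<le> b"
  shows "2 * sqrt (a * b) / (a + b) * sqrt (length ds * (\<Sum>d\<leftarrow>ds. d\<^sup>2)) \<le> sum_list ds"
proof (cases "ds = []")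
  case False
  then have b: "a \<le> b"
    using bnd[of "hd ds"] by auto
  let ?n = "real (length ds)" and ?S = "\<Sum>d\<leftarrow>ds. d\<^sup>2"
  have sum: "?S + ?n * (a * b) \<le> (a + b) * sum_list ds"
    using bnd
  proof (induction ds)
    case (Cons d ds)
    \<comment> \<open>Expanded, this is the contribution of \<open>d\<close> to the claim:
      \<open>d\<^sup>2 + a * b \<le> (a + b) * d\<close>.\<close>
    have "(d - a) * (b - d) \<ge> 0"
      using Cons.prems[of d] by simp
    with Cons show ?case
      by (simp add: algebra_simps power2_eq_square)
  qed simp
  have nonneg: "0 \<le> sum_list ds"
    using ab bnd by (intro sum_list_nonneg) fastforce
  show ?thesis
  proof (cases "a + b = 0")
    case True
    then show ?thesis
      using nonneg by simp
  next
    case nz: False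
    have "0 \<le> ?S"
      by (intro sum_list_nonneg) auto
    then have "2 * (sqrt (a * b) * sqrt (?n * ?S)) \<le> ?S + ?n * (a * b)"
      using arith_geo_mean_sqrt[of ?S "?n * (a * b)"] ab b
      by (simp add: real_sqrt_mult mult_ac)
    with sum nz ab b show ?thesis
      by (simp add: field_simps)
  qed
qed simp

theorem theorem5:
  fixes G :: "'a pair_pre_digraph" and vs :: "'a list" and n m :: nat and \<nu>1 \<nu>n :: real
  assumes "pair_graph G"
    and "Digraph_Component.connected (with_proj G)"
    and "distinct vs" and "set vs = pverts G"
    and "n = card (pverts G)" and "m = graph_size G"
    and "\<nu>1 = Max (set_mset (ecc_deviations G vs))"
    and "\<nu>n = Min (set_mset (ecc_deviations G vs))"
  shows "ecc_laplacian_energy G vs \<ge>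
    2 * sqrt (\<nu>1 * \<nu>n) / (\<nu>1 + \<nu>n) *
    sqrt (real n * zagreb_ecc G - (total_ecc G)\<^sup>2 + 2 * real m * real n)"
proof -
  interpret pair_graph G by fact
  let ?L = "ecc_laplacian G vs"
  define c where "c = total_ecc G / real n"
  have len: "length vs = n"
    using assms(3-5) distinct_card by metis
  have L: "?L \<in> carrier_mat n n"
    using ecc_laplacian_carrier[of G vs] by (simp add: len)
  obtain es where es: "char_poly ?L = (\<Prod>e\<leftarrow>es. [:- e, 1:])" "length es = n"
    using symmetric_real_mat_char_poly_linear_factors[OF L transpose_ecc_laplacian] .
  define ds where "ds = map (\<lambda>e. \<bar>e - c\<bar>) es"
  have dev: "ecc_deviations G vs = mset ds"
    using eigenvalue_mset_linear_factors[OF es(1)] assms(5)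
    by (simp add: ecc_deviations_def ds_def c_def)
  note traces = trace_linear_factors[OF L es(1)]
  have sq: "(\<Sum>e\<leftarrow>es. (e - c)\<^sup>2) = (\<Sum>e\<leftarrow>es. e\<^sup>2) - 2 * c * sum_list es + length es * c\<^sup>2"
    by (induction es) (simp_all add: algebra_simps power2_eq_square)
  have sum_sq: "(\<Sum>d\<leftarrow>ds. d\<^sup>2) = zagreb_ecc G + 2 * m - 2 * c * total_ecc G + n * c\<^sup>2"
    using sq trace_ecc_laplacian[OF assms(3,4)] trace_ecc_laplacian_square[OF assms(3,4)] traces
    by (simp add: ds_def o_def es(2) assms(6))
  \<comment> \<open>For \<open>n = 0\<close> the quotient \<open>c\<close> is 0 by convention, and
    the total eccentricity is an empty sum.\<close>
  have n_c: "total_ecc G = n * c"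
    using assms(5) by (cases "n = 0") (auto simp: c_def total_ecc_def)
  \<comment> \<open>By \<open>n_c\<close> the terms in \<open>c\<close> combine to
    \<open>- n * c\<^sup>2\<close>; the factor \<open>n\<close> turns this into minus the square of
    the total eccentricity.\<close>
  have S: "length ds * (\<Sum>d\<leftarrow>ds. d\<^sup>2) =
      real n * zagreb_ecc G - (total_ecc G)\<^sup>2 + 2 * real m * real n"
    unfolding sum_sq n_c by (simp add: ds_def es(2) algebra_simps power2_eq_square)
  show ?thesis
  \<comment> \<open>For an empty list \<open>Max\<close> and \<open>Min\<close> carry no
    information, but \<open>S\<close> makes the radicand 0, so both sides vanish.\<close>
  proof (cases "ds = []")
    case True
    then show ?thesis
      using S dev by (simp add: ecc_laplacian_energy_def)
  next
    case False
    then have "\<nu>n \<in> set ds"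
      unfolding assms(8) dev by (simp add: Min_in)
    then have "0 \<le> \<nu>n"
      by (auto simp: ds_def)
    moreover have "\<nu>n \<le> d \<and> d \<le> \<nu>1" if "d \<in> set ds" for d
      using that by (simp add: assms(7,8) dev)
    ultimately show ?thesis
      using sum_list_ge_sqrt_sum_squares[of \<nu>n ds \<nu>1] S
      by (simp add: ecc_laplacian_energy_def dev sum_mset_sum_list mult.commute add.commute)
  qed
qed

end
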